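(* Let $-1<q<1$ and let $a,b,c,d$ (real or complex) satisfy $|a|,|b|,|c|,|d|<1$. Then $$\frac{1}{2\pi}\int_{-1}^{1}\frac{1}{\sqrt{1-x^2}}\prod_{n\ge0}\frac{l(x|q^n)}{v(x|aq^n)\,v(x|bq^n)\,v(x|cq^n)\,v(x|dq^n)}\,dx=\frac{(abcd)_\infty}{(q,ab,ac,ad,bc,bd,cd)_\infty}.$$
   Context: $l(x|a)=(1+a)^2-4ax^2$, $v(x|t)=1-2tx+t^2$, $(a)_\infty=(a;q)_\infty=\prod_{j\ge0}(1-aq^j)$, $(a_1,\ldots,a_k)_\infty=\prod_{j=1}^k(a_j)_\infty$; $0^0=1$. *)

theory Defs
  imports "HOL-Analysis.Analysis"
begin

definition l :: "'a::comm_ring_1 \<Rightarrow> 'a \<Rightarrow> 'a" where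
  "l x a = (1 + a)\<^sup>2 - 4 * a * x\<^sup>2"

definition v :: "'a::comm_ring_1 \<Rightarrow> 'a \<Rightarrow> 'a" where
  "v x t = 1 - 2 * t * x + t\<^sup>2"

definition qpochhammer_inf :: "'a::real_normed_field \<Rightarrow> 'a \<Rightarrow> 'a" where
  "qpochhammer_inf q a = (\<Prod>j. 1 - a * q ^ j)"

definition qpochhammer_inf_list :: "'a::real_normed_field \<Rightarrow> 'a list \<Rightarrow> 'a" where
  "qpochhammer_inf_list q as = (\<Prod>a\<leftarrow>as. qpochhammer_inf q a)"

end

theory Submission
  imports Defs "HOL-Complex_Analysis.Complex_Analysis"
begin

text \<open>The substitution $x = \cos t$, $z = e^{it}$ turns the integral into half of the integral over the whole
  unit circle ($0 \le t \le 2\pi$) of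
  \[ \frac{(z^2, z^{-2})_\infty}{\prod_{p \in \{a,b,c,d\}} (pz, p/z)_\infty}. \]
  Write $J(a,b,c,d)$ for this circle integral and $P(a,b,c,d) = (abcd)_\infty / (ab,ac,ad,bc,bd,cd)_\infty$
  for the product that it should be proportional to. The claim is $J = 4\pi P/(q)_\infty$, for any complex
  $q$ in the unit disc.

  Replacing $a$ by $qa$ multiplies the integrand by $1 - a(z + 1/z) + a^2$. This is linear in $z + 1/z$,
  so that $z + 1/z$ can be eliminated between the parameters $a$ and $b$:
  \[ (b - a)(1 - ab)\,J(a,b,c,d) = b\,J(qa,b,c,d) - a\,J(a,qb,c,d), \]
  and $P$ satisfies the same equation (lemmas \<open>aw_integral_equation\<close>, \<open>aw_product_equation\<close>). Expanding in
  powers of $b$ shows that a solution holomorphic in $b$ is determined by its values at $b = 0$ and at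
  $a = 0$ (lemma \<open>functional_equation_unique\<close>). By the symmetry of $J$ and $P$, the parameters can be
  set to zero one after the other, and $J = C P$ follows from the case of a single parameter, in which
  $P = 1$ and $J(a,0,0,0)$ has to be independent of $a$.

  Up to this point the weight $(z^2, z^{-2})_\infty$ could be any other; now its form matters. The difference $J(a,0,0,0) - J(qa,0,0,0)$
  is, after symmetrisation in $z \mapsto 1/z$, a multiple of the integral of $f(sz)$ with $s^2 = q \neq 0$ and
  some $f$ that is holomorphic between the circles of radius $|s|$ and $1$ and satisfies
  $f(1/z) = -f(z)$, so it is zero (lemma \<open>aw_shift_integral\<close>, which
  treats $q = 0$ separately). Hence $J(a,0,0,0) = J(q^n a,0,0,0)$, and
  $n \to \infty$ gives $J(a,0,0,0) = J(0,0,0,0) = C$.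

  The constant $C$ comes from the parameters $s, -s, q, -q$: there the integrand is
  $(1 - z^2)(1 - z^{-2})$ with integral $4\pi$, and $P = (q)_\infty$.\<close>

section \<open>Integrals over the unit circle\<close>

definition circle_int :: "(complex \<Rightarrow> complex) \<Rightarrow> complex" where
  "circle_int h = integral {0..2 * pi} (\<lambda>t. h (cis t))"

lemma circle_int_integrable:
  fixes h :: "complex \<Rightarrow> complex"
  assumes "continuous_on (sphere 0 1) h"
  shows "(\<lambda>t. h (cis t)) integrable_on {a..b}"
proof (rule integrable_continuous_real)
  show "continuous_on {a..b} (\<lambda>t. h (cis t))"
    by (rule continuous_on_compose2[OF assms, of _ cis]) (auto intro!: continuous_intros)
qed

lemma circle_int_cong:
  "(\<And>z. norm z = 1 \<Longrightarrow> h z = g z) \<Longrightarrow> circle_int h = circle_int g"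
  unfolding circle_int_def by (intro integral_cong) auto

lemma circle_int_add:
  "continuous_on (sphere 0 1) h \<Longrightarrow> continuous_on (sphere 0 1) g \<Longrightarrow>
   circle_int (\<lambda>z. h z + g z) = circle_int h + circle_int g"
  unfolding circle_int_def by (intro integral_add circle_int_integrable)

lemma circle_int_diff:
  "continuous_on (sphere 0 1) h \<Longrightarrow> continuous_on (sphere 0 1) g \<Longrightarrow>
   circle_int (\<lambda>z. h z - g z) = circle_int h - circle_int g"
  unfolding circle_int_def by (intro integral_diff circle_int_integrable)

lemma circle_int_cmult: "circle_int (\<lambda>z. c * h z) = c * circle_int h"
  unfolding circle_int_def by simp

lemma integral_cis_inverse:
  fixes h :: "complex \<Rightarrow> complex"
  assumes "continuous_on (sphere 0 1) h"
  shows "integral {a..b} (\<lambda>t. h (inverse (cis t))) = integral {2 * pi - b..2 * pi - a} (\<lambda>t. h (cis t))"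
proof -
  have "integral {a..b} (\<lambda>t. h (inverse (cis t))) = integral {-b..-a} (\<lambda>t. h (cis t))"
    using Henstock_Kurzweil_Integration.integral_reflect_real[of "-a" "-b" "\<lambda>t. h (cis t)"] by simp
  also have "\<dots> = integral {-b..-a} ((\<lambda>t. h (cis t)) \<circ> (\<lambda>t. t + 2 * pi))"
    by (simp add: o_def flip: cis_mult)
  also have "\<dots> = integral {-b + 2 * pi..-a + 2 * pi} (\<lambda>t. h (cis t))"
    by (intro integral_shift continuous_on_compose2[OF assms] continuous_intros) auto
  finally show ?thesis by (simp add: add.commute)
qed

lemma circle_int_inverse:
  assumes "continuous_on (sphere 0 1) h"
  shows "circle_int (\<lambda>z. h (inverse z)) = circle_int h"
  unfolding circle_int_def using integral_cis_inverse[OF assms, of 0 "2 * pi"] by simp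

lemma circle_int_symmetric:
  assumes "continuous_on (sphere 0 1) h" "\<And>z. norm z = 1 \<Longrightarrow> h (inverse z) = h z"
  shows "circle_int h = 2 * integral {0..pi} (\<lambda>t. h (cis t))"
proof -
  have "circle_int h = integral {0..pi} (\<lambda>t. h (cis t)) + integral {pi..2 * pi} (\<lambda>t. h (cis t))"
    unfolding circle_int_def
    by (intro Henstock_Kurzweil_Integration.integral_combine[symmetric] circle_int_integrable assms) auto
  also have "integral {pi..2 * pi} (\<lambda>t. h (cis t)) = integral {0..pi} (\<lambda>t. h (inverse (cis t)))"
    using integral_cis_inverse[OF assms(1), of 0 pi] by simp
  also have "\<dots> = integral {0..pi} (\<lambda>t. h (cis t))"
    using assms(2)[of "cis t" for t] by (intro integral_cong) auto
  finally show ?thesis by simp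
qed

lemma circle_int_const:
  fixes c :: complex
  shows "circle_int (\<lambda>z. c) = 2 * of_real pi * c"
  unfolding circle_int_def by (simp add: scaleR_conv_of_real)

text \<open>If $U' = u$, then $-i\,U(e^{it})$ is a periodic antiderivative of $e^{it} u(e^{it})$.\<close>
lemma circle_int_mult_holomorphic:
  assumes "u holomorphic_on ball 0 r" "r > 1"
  shows "circle_int (\<lambda>z. z * u z) = 0"
proof -
  obtain U where U: "\<And>x. x \<in> ball 0 r \<Longrightarrow> (U has_field_derivative u x) (at x within ball 0 r)"
    using holomorphic_convex_primitive'[of "ball 0 r" u] assms(1) by auto
  have D: "((\<lambda>t. -\<i> * U (cis t)) has_vector_derivative cis t * u (cis t)) (at t within {0..2*pi})" for t
  proof -
    have "(U has_field_derivative u (cis t)) (at (cis t))"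
      using U[of "cis t"] assms(2) at_within_open[of "cis t" "ball 0 r"] by auto
    hence "((\<lambda>w. -\<i> * U (exp (\<i> * w))) has_field_derivative cis t * u (cis t)) (at (of_real t))"
      by (auto intro!: derivative_eq_intros DERIV_chain2[of U] simp: cis_conv_exp algebra_simps)
    from has_vector_derivative_real_field[OF this] show ?thesis
      by (simp add: cis_conv_exp o_def)
  qed
  have "((\<lambda>t. cis t * u (cis t)) has_integral (-\<i> * U (cis (2 * pi)) - (-\<i> * U (cis 0)))) {0..2*pi}"
    by (intro fundamental_theorem_of_calculus D) auto
  thus ?thesis unfolding circle_int_def by (simp add: integral_unique)
qed

text \<open>In the coordinate $z = e^x$ the annulus becomes a vertical strip, which is convex, and
  $x \mapsto \int_0^{2\pi} f(e^{x + it})\,dt$ has derivative zero there: differentiating in $x$ is the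
  same as differentiating in $t$ up to the factor $i$, and $f(e^{x+it})$ is periodic in $t$. Taking a
  complex multiplier $w$ changes the radius and rotates the circle at the same time.\<close>
lemma circle_int_scale:
  assumes f: "f holomorphic_on A" and A: "A = {z. r < norm z \<and> norm z < R}"
    and z: "w \<in> A" "1 \<in> A" and r: "0 \<le> r"
  shows "circle_int (\<lambda>z. f (w * z)) = circle_int f"
proof -
  have opA: "open A"
    unfolding A by (intro open_Collect_conj open_Collect_less continuous_intros)
  define S where "S = {x :: complex. r < exp (Re x) \<and> exp (Re x) < R}"
  have "convex S"
  proof -
    have *: "S = (if r = 0 then UNIV else {x. Re x > ln r}) \<inter> {x. Re x < ln R}"
    proof -
      have "R > 0" using z r A by auto
      moreover have "exp y < c \<longleftrightarrow> y < ln c" "c < exp y \<longleftrightarrow> ln c < y" if "c > 0" for y c :: real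
        using that by (metis exp_less_cancel_iff exp_ln)+
      ultimately show ?thesis using r by (auto simp: S_def)
    qed
    show ?thesis unfolding * by (auto intro!: convex_Int convex_halfspace_Re_gt convex_halfspace_Re_lt)
  qed
  define g where "g = (\<lambda>x t. f (exp x * cis t))"
  define g' where "g' = (\<lambda>x t. deriv f (exp x * cis t) * (exp x * cis t))"
  have inA: "exp x * cis t \<in> A" if "x \<in> S" for x t
    using that by (auto simp: A S_def norm_mult)
  have contf: "continuous_on A f" and contf': "continuous_on A (deriv f)"
    using f opA by (auto intro!: holomorphic_on_imp_continuous_on holomorphic_deriv)
  have fD: "(f has_field_derivative deriv f x) (at x)" if "x \<in> A" for x
    using that f opA by (rule holomorphic_derivI[rotated 2])
  have D1: "((\<lambda>x. g x t) has_field_derivative g' x t) (at x within S)" if "x \<in> S" for x t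
    unfolding g_def g'_def
    by (rule DERIV_chain2[of f _ "\<lambda>x. exp x * cis t" x, OF fD[OF inA[OF that]]
          DERIV_cmult_right[OF has_field_derivative_at_within[OF DERIV_exp]]])
  have L: "((\<lambda>x. integral (cbox 0 (2*pi)) (g x)) has_field_derivative integral (cbox 0 (2*pi)) (g' x)) (at x within S)"
    if "x \<in> S" for x
  proof (rule leibniz_rule_field_derivative)
    show "g x integrable_on cbox 0 (2 * pi)" if "x \<in> S" for x
      unfolding g_def using that
      by (intro integrable_continuous continuous_on_compose2[OF contf] continuous_intros)
         (auto intro: inA)
    show "continuous_on (S \<times> cbox 0 (2 * pi)) (\<lambda>(x, t). g' x t)"
      unfolding g'_def split_beta
      by (intro continuous_on_compose2[OF contf'] continuous_intros) (auto intro: inA)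
  qed (use D1 that \<open>convex S\<close> in simp_all)
  have Z: "integral (cbox 0 (2*pi)) (g' x) = 0" if x: "x \<in> S" for x
  proof -
    have D: "((\<lambda>t. -\<i> * f (exp x * cis t)) has_vector_derivative g' x t) (at t within {0..2*pi})" for t
    proof -
      have "(f has_field_derivative deriv f (exp x * cis t)) (at (exp x * exp (\<i> * of_real t)))"
        using fD[OF inA[OF x]] by (simp add: cis_conv_exp)
      hence "((\<lambda>w. -\<i> * f (exp x * exp (\<i> * w))) has_field_derivative g' x t) (at (of_real t))"
        by (auto intro!: derivative_eq_intros DERIV_chain2[of f] simp: cis_conv_exp g'_def algebra_simps)
      from has_vector_derivative_real_field[OF this] show ?thesis
        by (simp add: cis_conv_exp o_def)
    qed
    have "((\<lambda>t. g' x t) has_integral (-\<i> * f (exp x * cis (2 * pi)) - (-\<i> * f (exp x * cis 0)))) {0..2*pi}"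
      by (intro fundamental_theorem_of_calculus D) auto
    thus ?thesis by (simp add: integral_unique cbox_interval)
  qed
  have "((\<lambda>x. integral (cbox 0 (2*pi)) (g x)) has_field_derivative 0) (at x within S)"
    if "x \<in> S" for x using L[OF that] unfolding Z[OF that] .
  from has_field_derivative_zero_constant[OF \<open>convex S\<close> this]
  obtain c where c: "\<And>x. x \<in> S \<Longrightarrow> integral (cbox 0 (2*pi)) (g x) = c"
    by auto
  have "w \<noteq> 0" using z r by (auto simp: A)
  hence "integral {0..2*pi} (\<lambda>t. f (w * cis t)) = c"
    using c[of "Ln w"] z by (simp add: S_def A g_def cbox_interval)
  moreover have "integral {0..2*pi} (\<lambda>t. f (cis t)) = c"
    using c[of 0] z by (simp add: S_def A g_def cbox_interval)
  ultimately show ?thesis by (simp add: circle_int_def)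
qed

section \<open>A functional equation with a unique solution\<close>

lemma norm_mult_less_1: "norm a < 1 \<Longrightarrow> norm b < 1 \<Longrightarrow> norm (a * b) < 1" for a b :: complex
  using mult_strict_mono'[of "norm a" 1 "norm b" 1] by (simp add: norm_mult)

text \<open>Comparing coefficients of $b^n$ in the equation gives
  \[ a (1 - q^n) F_n(a) = (1 + a^2) F_{n-1}(a) - F_{n-1}(qa) - a F_{n-2}(a), \]
  where $F_n(a)$ is the coefficient of $b^n$ in $F(a, b)$, so that all $F_n$ vanish for $a \neq 0$ once
  $F_0$ does. At $a = 0$ the recurrence is empty. This point can be reached ($q = 0$ gives $qa = 0$),
  and there the hypothesis on $F(0, b)$ takes over.\<close>
lemma functional_equation_unique:
  fixes F :: "complex \<Rightarrow> complex \<Rightarrow> complex"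
  assumes q: "norm q < 1"
    and holo: "\<And>a. norm a < 1 \<Longrightarrow> F a holomorphic_on ball 0 1"
    and F_left: "\<And>a. norm a < 1 \<Longrightarrow> F a 0 = 0"
    and F_right: "\<And>b. norm b < 1 \<Longrightarrow> F 0 b = 0"
    and eq: "\<And>a b. norm a < 1 \<Longrightarrow> norm b < 1 \<Longrightarrow>
               (b - a) * (1 - a * b) * F a b = b * F (q * a) b - a * F a (q * b)"
    and ab: "norm a < 1" "norm b < 1"
  shows "F a b = 0"
proof -
  define E where "E = (\<lambda>a. fps_expansion (F a) 0)"
  have E: "F a has_fps_expansion E a" if "norm a < 1" for a
    unfolding E_def
    using holo[OF that] by (intro analytic_at_imp_has_fps_expansion_0) (auto simp: analytic_at intro!: exI[of _ "ball 0 1"])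
  have ev: "\<forall>\<^sub>F b in nhds 0. norm (b :: complex) < 1"
    using eventually_nhds_in_open[of "ball 0 1" "0 :: complex"] by (simp add: mem_ball_0)
  have rec: "fps_X * E a * fps_const (1 + a\<^sup>2) - fps_const a * E a - fps_const a * (fps_X * (fps_X * E a)) =
             fps_X * E (q * a) - fps_const a * fps_compose (E a) (fps_const q * fps_X)"
    if a: "norm a < 1" for a
  proof -
    have qa: "norm (q * a) < 1"
      using q a by (rule norm_mult_less_1)
    have comp: "(F a \<circ> (\<lambda>b. q * b)) has_fps_expansion fps_compose (E a) (fps_const q * fps_X)"
      by (intro has_fps_expansion_compose E a fps_expansion_intros) auto
    have R: "(\<lambda>b. b * F (q * a) b - a * (F a \<circ> (\<lambda>b. q * b)) b) has_fps_expansion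
            fps_X * E (q * a) - fps_const a * fps_compose (E a) (fps_const q * fps_X)"
      by (intro fps_expansion_intros E qa comp)
    have L: "(\<lambda>b. b * F a b * (1 + a\<^sup>2) - a * F a b - a * (b * (b * F a b))) has_fps_expansion
        fps_X * E a * fps_const (1 + a\<^sup>2) - fps_const a * E a - fps_const a * (fps_X * (fps_X * E a))"
      by (intro fps_expansion_intros E a)
    have "\<forall>\<^sub>F b in nhds 0. b * F a b * (1 + a\<^sup>2) - a * F a b - a * (b * (b * F a b)) =
                     b * F (q * a) b - a * (F a \<circ> (\<lambda>b. q * b)) b"
      using ev
    proof eventually_elim
      case (elim b)
      show ?case using eq[OF a elim] by (simp add: algebra_simps power2_eq_square)
    qed
    from L[unfolded has_fps_expansion_cong[OF this refl]] R show ?thesis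
      by (rule fps_expansion_unique_complex)
  qed
  have E0: "\<forall>a. norm a < 1 \<longrightarrow> fps_nth (E a) n = 0" for n
  proof (induction n rule: less_induct)
    case (less n)
    show ?case
    proof (intro allI impI)
      fix a :: complex assume a: "norm a < 1"
      have qa: "norm (q * a) < 1"
        using q a by (rule norm_mult_less_1)
      show "fps_nth (E a) n = 0"
      proof (cases n)
        case 0
        thus ?thesis
          using has_fps_expansion_imp_0_eq_fps_nth_0[OF E[OF a]] F_left[OF a] by simp
      next
        case (Suc m)
        show ?thesis
        proof (cases "a = 0")
          case True
          have "\<forall>\<^sub>F b in nhds 0. F 0 b = 0"
            using ev by eventually_elim (rule F_right)
          hence "F 0 has_fps_expansion 0" by (simp add: has_fps_expansion_0_iff)
          hence "E 0 = 0" using E[of 0] fps_expansion_unique_complex by force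
          thus ?thesis using True by simp
        next
          case False
          have IH: "fps_nth (E a) m = 0" "fps_nth (E (q * a)) m = 0" "m > 0 \<Longrightarrow> fps_nth (E a) (m - 1) = 0"
            using less Suc a qa by auto
          have "fps_nth (fps_X * E a * fps_const (1 + a\<^sup>2) - fps_const a * E a - fps_const a * (fps_X * (fps_X * E a))) n =
                fps_nth (fps_X * E (q * a) - fps_const a * fps_compose (E a) (fps_const q * fps_X)) n"
            by (simp only: rec[OF a])
          hence "a * fps_nth (E a) n = a * (q ^ n * fps_nth (E a) n)"
            using IH Suc by (cases "m = 0") (auto simp: fps_nth_compose_linear)
          moreover have "q ^ n \<noteq> 1"
          proof
            assume "q ^ n = 1"
            hence "norm q ^ n = 1" by (metis norm_one norm_power)
            thus False using q Suc power_less_one_iff[of "norm q" n] by simp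
          qed
          ultimately show ?thesis using False by auto
        qed
      qed
    qed
  qed
  have "E a = 0" using E0 ab(1) by (auto simp: fps_eq_iff)
  hence "F a has_fps_expansion 0" using E[OF ab(1)] by simp
  thus ?thesis
    using has_fps_expansion_0_analytic_continuation[of "F a" "ball 0 1" b] holo[OF ab(1)] ab(2) by auto
qed

section \<open>Integral and product as functions of the parameters\<close>

abbreviation (input) Q :: "complex \<Rightarrow> complex \<Rightarrow> complex" where
  "Q \<equiv> qpochhammer_inf"

definition aw_weight :: "complex \<Rightarrow> complex \<Rightarrow> complex" where
  "aw_weight q z = Q q (z\<^sup>2) * Q q (inverse (z\<^sup>2))"

definition aw_factor :: "complex \<Rightarrow> complex \<Rightarrow> complex \<Rightarrow> complex" where
  "aw_factor q a z = Q q (a * z) * Q q (a * inverse z)"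

definition aw_integrand :: "complex \<Rightarrow> complex \<Rightarrow> complex \<Rightarrow> complex \<Rightarrow> complex \<Rightarrow> complex \<Rightarrow> complex" where
  "aw_integrand q a b c d z =
     aw_weight q z / (aw_factor q a z * aw_factor q b z * aw_factor q c z * aw_factor q d z)"

text \<open>The angle runs over the full circle, twice the range $0 \le t \le \pi$ that comes from
  $x = \cos t$, because only a closed circle can be reflected and moved to another radius.\<close>
definition aw_integral :: "complex \<Rightarrow> complex \<Rightarrow> complex \<Rightarrow> complex \<Rightarrow> complex \<Rightarrow> complex" where
  "aw_integral q a b c d = circle_int (aw_integrand q a b c d)"

definition aw_product :: "complex \<Rightarrow> complex \<Rightarrow> complex \<Rightarrow> complex \<Rightarrow> complex \<Rightarrow> complex" where
  "aw_product q a b c d = Q q (a * b * c * d) /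
     (Q q (a * b) * Q q (a * c) * Q q (a * d) *
      Q q (b * c) * Q q (b * d) * Q q (c * d))"

lemma aw_integral_commute:
  "aw_integral q a b c d = aw_integral q b a c d"
  "aw_integral q a b c d = aw_integral q a c b d"
  "aw_integral q a b c d = aw_integral q a b d c"
  unfolding aw_integral_def by (rule circle_int_cong, simp add: aw_integrand_def mult_ac)+

lemma aw_product_commute:
  "aw_product q a b c d = aw_product q b a c d"
  "aw_product q a b c d = aw_product q a c b d"
  "aw_product q a b c d = aw_product q a b d c"
  by (simp_all add: aw_product_def mult_ac)

context
  fixes q :: complex
  assumes q: "norm q < 1"
begin

section \<open>The infinite q-shifted factorial as an entire function\<close>

lemma qpoch_abs_convergent: "abs_convergent_prod (\<lambda>j. 1 - x * q ^ j)"
proof -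
  have "summable (\<lambda>j. norm x * norm q ^ j)"
    using q by (intro summable_mult summable_geometric) auto
  thus ?thesis
    by (simp add: abs_convergent_prod_conv_summable norm_mult norm_power)
qed

lemma qpoch_has_prod: "(\<lambda>j. 1 - x * q ^ j) has_prod Q q x"
  unfolding qpochhammer_inf_def
  using abs_convergent_prod_imp_convergent_prod[OF qpoch_abs_convergent] by (rule convergent_prod_has_prod)

lemma qpoch_nonzero:
  assumes "norm x < 1"
  shows "Q q x \<noteq> 0"
proof -
  have "1 - x * q ^ j \<noteq> 0" for j
  proof
    assume "1 - x * q ^ j = 0"
    hence "norm (x * q ^ j) = 1" by simp
    moreover have "norm x * norm q ^ j \<le> norm x * 1"
      using q by (intro mult_left_mono power_le_one) auto
    ultimately show False using assms by (simp add: norm_mult norm_power)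
  qed
  thus ?thesis unfolding qpochhammer_inf_def
    using abs_convergent_prod_imp_convergent_prod[OF qpoch_abs_convergent] by (intro prodinf_nonzero) auto
qed

lemma qpoch_0 [simp]: "Q q 0 = 1"
  by (simp add: qpochhammer_inf_def)

lemma qpoch_step: "Q q x = (1 - x) * Q q (q * x)"
proof -
  have "(\<lambda>j. 1 - x * q ^ Suc j) has_prod Q q (q * x)"
    using qpoch_has_prod[of "q * x"] by (simp add: mult_ac)
  hence "(\<lambda>j. 1 - x * q ^ j) has_prod (Q q (q * x) * (1 - x * q ^ 0))"
    by (rule has_prod_Suc_imp)
  thus ?thesis using qpoch_has_prod[of x] has_prod_unique2 by (simp add: mult.commute) blast
qed

lemma qpoch_LIMSEQ: "(\<lambda>n. \<Prod>j<n. 1 - x * q ^ j) \<longlonglongrightarrow> Q q x"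
  by (rule has_prod_imp_tendsto'[OF qpoch_has_prod])

text \<open>By the M-test the partial products converge uniformly on every disc of radius 1.\<close>
lemma qpoch_entire: "Q q holomorphic_on UNIV"
proof (rule holomorphic_uniform_sequence[where f = "\<lambda>n x. \<Prod>j<n. 1 - x * q ^ j"])
  show "(\<lambda>x. \<Prod>j<n. 1 - x * q ^ j) holomorphic_on UNIV" for n
    by (intro holomorphic_intros)
  fix x :: complex
  have "uniformly_convergent_on (cball x 1) (\<lambda>n x. \<Prod>j<n. 1 - x * q ^ j)"
  proof (rule uniformly_convergent_on_prod')
    show "uniformly_convergent_on (cball x 1) (\<lambda>N x. \<Sum>n<N. norm (1 - x * q ^ n - 1))"
    proof (rule Weierstrass_m_test'_ev)
      have "norm (y * q ^ n) \<le> (norm x + 1) * norm q ^ n" if "y \<in> cball x 1" for y n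
      proof -
        have "norm y \<le> norm x + 1"
          using that norm_triangle_sub[of y x] by (auto simp: dist_norm norm_minus_commute)
        thus ?thesis by (simp add: norm_mult norm_power mult_right_mono)
      qed
      thus "\<forall>\<^sub>F n in sequentially. \<forall>y\<in>cball x 1. norm (norm (1 - y * q ^ n - 1)) \<le> (norm x + 1) * norm q ^ n"
        by simp
      show "summable (\<lambda>n. (norm x + 1) * norm q ^ n)"
        using q by (intro summable_mult summable_geometric) auto
    qed
  qed (auto intro!: continuous_intros)
  then obtain L where L: "uniform_limit (cball x 1) (\<lambda>n x. \<Prod>j<n. 1 - x * q ^ j) L sequentially"
    unfolding uniformly_convergent_on_def by blast
  have "L y = Q q y" if "y \<in> cball x 1" for y
    using tendsto_uniform_limitI[OF L that] qpoch_LIMSEQ LIMSEQ_unique by blast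
  hence "uniform_limit (cball x 1) (\<lambda>n x. \<Prod>j<n. 1 - x * q ^ j) (Q q) sequentially"
    using L by (subst uniform_limit_cong'[where g = "\<lambda>n x. \<Prod>j<n. 1 - x * q ^ j" and i = L]) auto
  thus "\<exists>d>0. cball x d \<subseteq> UNIV \<and> uniform_limit (cball x d) (\<lambda>n x. \<Prod>j<n. 1 - x * q ^ j) (Q q) sequentially"
    by (intro exI[of _ 1]) auto
qed auto

lemma qpoch_holomorphic_on:
  "f holomorphic_on A \<Longrightarrow> (\<lambda>z. Q q (f z)) holomorphic_on A"
  using holomorphic_on_compose_gen[OF _ qpoch_entire] by (auto simp: o_def)

lemma qpoch_continuous_on:
  fixes f :: "'a :: topological_space \<Rightarrow> complex"
  shows "continuous_on A f \<Longrightarrow> continuous_on A (\<lambda>z. Q q (f z))"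
  using continuous_on_compose2[OF holomorphic_on_imp_continuous_on[OF qpoch_entire]] by blast

lemma qpoch_has_field_derivative:
  "(f has_field_derivative f') (at x within A) \<Longrightarrow>
     ((\<lambda>z. Q q (f z)) has_field_derivative deriv (Q q) (f x) * f') (at x within A)"
  using holomorphic_derivI[OF qpoch_entire open_UNIV] DERIV_chain2 by blast

lemma deriv_qpoch_continuous_on:
  fixes f :: "'a :: topological_space \<Rightarrow> complex"
  shows "continuous_on A f \<Longrightarrow> continuous_on A (\<lambda>z. deriv (Q q) (f z))"
  using continuous_on_compose2[OF holomorphic_on_imp_continuous_on[OF holomorphic_deriv[OF qpoch_entire open_UNIV]]]
  by blast

lemma norm_sqrt_less_1:
  assumes "s\<^sup>2 = q"
  shows "norm s < 1"
  using q assms by (metis abs_norm_cancel norm_power abs_square_less_1)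

text \<open>The factors of the left-hand side with even index $2j$ are $1 - z^2 s^{4j} = (1 - z s^{2j})(1 + z s^{2j})$,
  those with odd index split in the same way. Instead of reordering infinite products, the proof
  uses that the right-hand side $G$ satisfies $G(z) = (1 - z^2)\,G(sz)$ and is continuous with
  $G(0) = 1$.\<close>
lemma qpoch_square:
  assumes s: "s\<^sup>2 = q"
  shows "Q q (z\<^sup>2) = Q q z * Q q (- z) * Q q (s * z) * Q q (- (s * z))"
proof -
  define G where "G = (\<lambda>z. Q q z * Q q (- z) * Q q (s * z) * Q q (- (s * z)))"
  have G_step: "G z = (1 - z\<^sup>2) * G (s * z)" for z
  proof -
    have "Q q (s * (s * z)) = Q q (q * z)" using s by (simp add: power2_eq_square mult.assoc[symmetric])
    moreover have "Q q (- (s * (s * z))) = Q q (- (q * z))"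
      using s by (simp add: power2_eq_square mult.assoc[symmetric])
    ultimately show ?thesis unfolding G_def qpoch_step[of z] qpoch_step[of "-z"]
      by (simp add: power2_eq_square algebra_simps)
  qed
  have iter: "G z = (\<Prod>j<n. 1 - z\<^sup>2 * q ^ j) * G (s ^ n * z)" for n
  proof (induction n)
    case (Suc n)
    have "(s ^ n * z)\<^sup>2 = z\<^sup>2 * q ^ n" 
      by (simp add: s[symmetric] power_mult_distrib power_mult[symmetric] mult.commute)
    thus ?case using Suc G_step[of "s ^ n * z"] by (simp add: mult_ac)
  qed auto
  have s1: "norm s < 1"
    by (rule norm_sqrt_less_1[OF s])
  have "(\<lambda>n. s ^ n * z) \<longlonglongrightarrow> 0"
    using tendsto_mult_left_zero[OF LIMSEQ_power_zero[OF s1]] by simp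
  moreover have "continuous_on UNIV G"
    unfolding G_def by (intro continuous_intros qpoch_continuous_on)
  hence "isCont G 0" by (simp add: continuous_on_eq_continuous_at)
  ultimately have "(\<lambda>n. G (s ^ n * z)) \<longlonglongrightarrow> G 0"
    by (rule isCont_tendsto_compose[rotated])
  hence "(\<lambda>n. (\<Prod>j<n. 1 - z\<^sup>2 * q ^ j) * G (s ^ n * z)) \<longlonglongrightarrow> Q q (z\<^sup>2) * G 0"
    by (intro tendsto_mult qpoch_LIMSEQ)
  hence "G z = Q q (z\<^sup>2) * G 0" unfolding iter[symmetric] by (simp add: LIMSEQ_const_iff)
  thus ?thesis by (simp add: G_def)
qed

section \<open>The functional equation for the integral and for the product\<close>

lemma aw_factor_0 [simp]: "aw_factor q 0 z = 1"
  by (simp add: aw_factor_def qpoch_0)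

lemma aw_factor_nonzero:
  assumes "norm a < 1" "norm z = 1"
  shows "aw_factor q a z \<noteq> 0"
  using assms by (simp add: aw_factor_def qpoch_nonzero norm_mult norm_inverse)

lemma aw_factor_step:
  assumes "z \<noteq> 0"
  shows "aw_factor q a z = (1 - a * z) * (1 - a * inverse z) * aw_factor q (q * a) z"
  unfolding aw_factor_def qpoch_step[of "a * z"] qpoch_step[of "a * inverse z"] by (simp add: mult_ac)

lemma aw_integrand_continuous:
  assumes "norm a < 1" "norm b < 1" "norm c < 1" "norm d < 1"
  shows "continuous_on (sphere 0 1) (aw_integrand q a b c d)"
proof -
  have "continuous_on (sphere 0 1)
    (\<lambda>z. aw_weight q z / (aw_factor q a z * aw_factor q b z * aw_factor q c z * aw_factor q d z))"
  proof (intro continuous_on_divide ballI)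
    fix z :: complex assume "z \<in> sphere 0 1"
    thus "aw_factor q a z * aw_factor q b z * aw_factor q c z * aw_factor q d z \<noteq> 0"
      using assms by (simp add: aw_factor_nonzero)
  qed (auto simp: aw_weight_def aw_factor_def intro!: continuous_intros qpoch_continuous_on)
  thus ?thesis by (simp add: aw_integrand_def[abs_def])
qed

text \<open>This holds already for the integrands: passing from $a$ to $qa$ multiplies the integrand by
  $A(z) = (1 - az)(1 - a/z)$, which is linear in $z + 1/z$, so a suitable combination of $A$ and
  the corresponding $B$ for the parameter $b$ is the constant
  $b A - a B = (b - a)(1 - ab)$.\<close>
lemma aw_integral_equation:
  assumes "norm a < 1" "norm b < 1" "norm c < 1" "norm d < 1"
  shows "(b - a) * (1 - a * b) * aw_integral q a b c d =
           b * aw_integral q (q * a) b c d - a * aw_integral q a (q * b) c d"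
proof -
  have "(b - a) * (1 - a * b) * aw_integral q a b c d =
          circle_int (\<lambda>z. (b - a) * (1 - a * b) * aw_integrand q a b c d z)"
    unfolding aw_integral_def by (rule circle_int_cmult[symmetric])
  also have "\<dots> = circle_int (\<lambda>z. b * aw_integrand q (q * a) b c d z - a * aw_integrand q a (q * b) c d z)"
  proof (rule circle_int_cong)
    fix z :: complex assume z: "norm z = 1"
    hence z0: "z \<noteq> 0" by auto
    note nz = aw_factor_nonzero[OF assms(1) z] aw_factor_nonzero[OF assms(2) z]
    define A where "A = (1 - a * z) * (1 - a * inverse z)"
    define B where "B = (1 - b * z) * (1 - b * inverse z)"
    define w where "w = aw_weight q z / (aw_factor q c z * aw_factor q d z)"
    have fa: "aw_factor q a z = A * aw_factor q (q * a) z" and fb: "aw_factor q b z = B * aw_factor q (q * b) z"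
      unfolding A_def B_def by (rule aw_factor_step[OF z0])+
    have i1: "aw_integrand q (q * a) b c d z = w * A / (aw_factor q a z * aw_factor q b z)"
      using nz unfolding fa by (simp add: aw_integrand_def w_def field_simps)
    have i2: "aw_integrand q a (q * b) c d z = w * B / (aw_factor q a z * aw_factor q b z)"
      using nz unfolding fb by (simp add: aw_integrand_def w_def field_simps)
    have i3: "aw_integrand q a b c d z = w / (aw_factor q a z * aw_factor q b z)"
      by (simp add: aw_integrand_def w_def field_simps)
    have AB: "b * A - a * B = (b - a) * (1 - a * b)"
      using z0 by (simp add: A_def B_def field_simps)
    show "(b - a) * (1 - a * b) * aw_integrand q a b c d z =
        b * aw_integrand q (q * a) b c d z - a * aw_integrand q a (q * b) c d z"
      unfolding i1 i2 i3 AB[symmetric] by (simp add: algebra_simps diff_divide_distrib)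
  qed
  also have "\<dots> = circle_int (\<lambda>z. b * aw_integrand q (q * a) b c d z) - circle_int (\<lambda>z. a * aw_integrand q a (q * b) c d z)"
    using assms q by (intro circle_int_diff continuous_intros aw_integrand_continuous norm_mult_less_1)
  finally show ?thesis by (simp add: aw_integral_def circle_int_cmult)
qed

text \<open>After division by common factors this is the polynomial identity
  $b(1 - ac)(1 - ad) - a(1 - bc)(1 - bd) = (b - a)(1 - abcd)$.\<close>
lemma aw_product_equation:
  assumes "norm a < 1" "norm b < 1" "norm c < 1" "norm d < 1"
  shows "(b - a) * (1 - a * b) * aw_product q a b c d =
           b * aw_product q (q * a) b c d - a * aw_product q a (q * b) c d"
proof -
  note lt = norm_mult_less_1 assms
  have nz: "Q q (a * b) \<noteq> 0" "Q q (a * c) \<noteq> 0" "Q q (a * d) \<noteq> 0"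
      "Q q (b * c) \<noteq> 0" "Q q (b * d) \<noteq> 0" "Q q (c * d) \<noteq> 0"
    by (intro qpoch_nonzero lt)+
  define X where "X = Q q (q * (a * b * c * d)) /
     (Q q (a * b) * Q q (a * c) * Q q (a * d) *
      Q q (b * c) * Q q (b * d) * Q q (c * d))"
  have "aw_product q a b c d = (1 - a * b * c * d) * X"
    unfolding aw_product_def X_def qpoch_step[of "a * b * c * d"] by simp
  moreover have "aw_product q (q * a) b c d = (1 - a * b) * (1 - a * c) * (1 - a * d) * X"
    unfolding aw_product_def X_def using nz
    unfolding qpoch_step[of "a * b"] qpoch_step[of "a * c"] qpoch_step[of "a * d"]
    by (simp add: mult_ac)
  moreover have "aw_product q a (q * b) c d = (1 - a * b) * (1 - b * c) * (1 - b * d) * X"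
    unfolding aw_product_def X_def using nz
    unfolding qpoch_step[of "a * b"] qpoch_step[of "b * c"] qpoch_step[of "b * d"]
    by (simp add: mult_ac)
  ultimately show ?thesis by (simp only:) (simp add: algebra_simps)
qed

lemma aw_product_holomorphic:
  assumes "norm a < 1" "norm c < 1" "norm d < 1"
  shows "(\<lambda>b. aw_product q a b c d) holomorphic_on ball 0 1"
  unfolding aw_product_def
proof (intro holomorphic_intros qpoch_holomorphic_on)
  fix b :: complex assume "b \<in> ball 0 1"
  hence b: "norm b < 1" by simp
  note lt = norm_mult_less_1 assms b
  have "Q q (a * b) \<noteq> 0" "Q q (a * c) \<noteq> 0" "Q q (a * d) \<noteq> 0"
      "Q q (b * c) \<noteq> 0" "Q q (b * d) \<noteq> 0" "Q q (c * d) \<noteq> 0"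
    by (intro qpoch_nonzero lt)+
  thus "Q q (a * b) * Q q (a * c) * Q q (a * d) *
          Q q (b * c) * Q q (b * d) * Q q (c * d) \<noteq> 0"
    by simp
qed

lemma aw_integral_holomorphic:
  assumes "norm a < 1" "norm c < 1" "norm d < 1"
  shows "(\<lambda>b. aw_integral q a b c d) holomorphic_on ball 0 1"
proof -
  define D where "D = (\<lambda>b z. deriv (Q q) (b * z) * z * Q q (b * inverse z) +
                        Q q (b * z) * (deriv (Q q) (b * inverse z) * inverse z))"
  define w where "w = aw_integrand q a 0 c d"
  have w: "continuous_on (sphere 0 1) w"
    unfolding w_def using assms by (intro aw_integrand_continuous) auto
  have split: "aw_integrand q a b c d z = w z / aw_factor q b z" for b z
    by (simp add: w_def aw_integrand_def)
  have D: "((\<lambda>b. aw_factor q b z) has_field_derivative D b z) (at b within S)" for b z S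
    unfolding aw_factor_def D_def by (auto intro!: derivative_eq_intros qpoch_has_field_derivative)
  have "(\<lambda>b. integral (cbox 0 (2 * pi)) (\<lambda>t. w (cis t) / aw_factor q b (cis t))) holomorphic_on ball 0 1"
  proof (rule leibniz_rule_holomorphic)
    fix b t assume b: "b \<in> ball (0::complex) 1"
    show "((\<lambda>b. w (cis t) / aw_factor q b (cis t)) has_field_derivative
            - (w (cis t) * D b (cis t)) / (aw_factor q b (cis t) * aw_factor q b (cis t))) (at b within ball 0 1)"
      using b by (auto intro!: derivative_eq_intros D simp: aw_factor_nonzero)
  next
    fix b :: complex assume b: "b \<in> ball 0 1"
    show "(\<lambda>t. w (cis t) / aw_factor q b (cis t)) integrable_on cbox 0 (2 * pi)"
      unfolding split[symmetric] cbox_interval using assms b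
      by (intro circle_int_integrable aw_integrand_continuous) auto
  next
    have "continuous_on (ball 0 1 \<times> cbox 0 (2 * pi)) (\<lambda>p. w (cis (snd p)))"
      by (intro continuous_on_compose2[OF w] continuous_intros) auto
    thus "continuous_on (ball 0 1 \<times> cbox 0 (2 * pi)) (\<lambda>(b, t). - (w (cis t) * D b (cis t)) /
            (aw_factor q b (cis t) * aw_factor q b (cis t)))"
      unfolding split_beta D_def aw_factor_def
      by (intro continuous_intros qpoch_continuous_on deriv_qpoch_continuous_on)
         (auto simp: qpoch_nonzero norm_mult norm_inverse simp flip: aw_factor_def)
  qed auto
  thus ?thesis by (simp add: aw_integral_def circle_int_def split cbox_interval)
qed

section \<open>The case of one parameter\<close>

text \<open>For $q \neq 0$ and $s^2 = q$ the integrand is $s f(sz)$ with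
  \[ f(z) = \frac{(1/z - z)\,(qz^2, q/z^2)_\infty}{(asz, as/z)_\infty}. \]
  This function is holomorphic on an annulus that contains both the unit circle and the circle of
  radius $|s|$, so the dilation by $s$ does not change the integral. And $f(1/z) = -f(z)$, so the
  integral of $f$ over the unit circle is zero. For $q = 0$ the dilation degenerates, but then
  $z \mapsto 1/z$ turns the integrand into $z (1 - z^2)/(1 - az)$, which is $z$ times a function
  holomorphic on a disc of radius larger than 1.\<close>
lemma aw_shift_integral:
  assumes a: "norm a < 1"
  shows "circle_int (\<lambda>z. (inverse z - a) * (1 - inverse (z\<^sup>2)) *
           (Q q (q * z\<^sup>2) * Q q (q * inverse (z\<^sup>2))) / aw_factor q a z) = 0"
    (is "circle_int ?g = 0")
proof (cases "q = 0")
  case True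
  have Q0: "Q q x = 1 - x" for x
    using qpoch_step[of x] qpoch_0 True by simp
  have g: "continuous_on (sphere 0 1) ?g"
    by (intro continuous_intros qpoch_continuous_on)
       (use a in \<open>auto simp: aw_factor_def qpoch_nonzero norm_mult norm_inverse intro!: continuous_intros qpoch_continuous_on\<close>)
  have "circle_int ?g = circle_int (\<lambda>z. ?g (inverse z))"
    by (rule circle_int_inverse[OF g, symmetric])
  also have "\<dots> = circle_int (\<lambda>z. z * ((1 - z\<^sup>2) / (1 - a * z)))"
  proof (rule circle_int_cong)
    fix z :: complex assume z: "norm z = 1"
    hence "z \<noteq> 0" "z \<noteq> a" "norm (a * z) \<noteq> 1" using a by (auto simp: norm_mult)
    moreover from this have "a * z \<noteq> 1" by auto
    ultimately show "?g (inverse z) = z * ((1 - z\<^sup>2) / (1 - a * z))"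
      unfolding aw_factor_def Q0 using True by (simp add: divide_simps)
  qed
  also have "\<dots> = 0"
  proof (rule circle_int_mult_holomorphic)
    \<comment> \<open>a radius between $1$ and the modulus $1/|a|$ of the pole that is also meaningful for $a = 0$\<close>
    show "2 / (1 + norm a) > 1" using a by (simp add: field_simps add_pos_nonneg)
    have "a * z \<noteq> 1" if "norm z < 2 / (1 + norm a)" for z
    proof
      assume "a * z = 1"
      hence *: "norm a * norm z = 1" by (metis norm_mult norm_one)
      have "norm z * (1 + norm a) < 2" using that by (simp add: field_simps add_pos_nonneg)
      hence "norm z < 1" using * by (simp add: algebra_simps)
      thus False using * a norm_mult_less_1[of a z] by (simp add: norm_mult)
    qed
    thus "(\<lambda>z. (1 - z\<^sup>2) / (1 - a * z)) holomorphic_on ball 0 (2 / (1 + norm a))"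
      by (intro holomorphic_intros) auto
  qed
  finally show ?thesis .
next
  case False
  define s where "s = csqrt q"
  have s: "s\<^sup>2 = q" "s \<noteq> 0" using False by (auto simp: s_def)
  have s1: "norm s < 1"
    using s by (intro norm_sqrt_less_1)
  define f where "f = (\<lambda>z. (inverse z - z) * (Q q (q * z\<^sup>2) * Q q (q * inverse (z\<^sup>2))) /
      (Q q (a * s * z) * Q q (a * s * inverse z)))"
  \<comment> \<open>The natural outer radius would be $1/|as|$. The smaller $1/|s|$ also makes sense for $a = 0$.\<close>
  define A where "A = {z :: complex. norm (a * s) < norm z \<and> norm z < 1 / norm s}"
  have A: "norm (a * s * z) < 1" "norm (a * s * inverse z) < 1" "z \<noteq> 0" if "z \<in> A" for z :: complex
  proof -
    have "norm s * norm z < 1" using that s by (auto simp: A_def field_simps)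
    hence "norm (a * (s * z)) < 1" using norm_mult_less_1[OF a, of "s * z"] by (simp add: norm_mult)
    thus "norm (a * s * z) < 1" by (simp add: mult.assoc)
    show "z \<noteq> 0" using that by (auto simp: A_def)
    thus "norm (a * s * inverse z) < 1" using that by (auto simp: A_def norm_mult norm_divide field_simps)
  qed
  have sA: "s \<in> A" and oneA: "1 \<in> A"
    using s s1 a norm_mult_less_1[of a s] mult_strict_mono'[of "norm s" 1 "norm s" 1]
    by (auto simp: A_def norm_mult field_simps)
  have sphA: "z \<in> A" if "norm z = 1" for z using that oneA by (auto simp: A_def)
  have f_holo: "f holomorphic_on A"
    unfolding f_def
    by (intro holomorphic_intros qpoch_holomorphic_on) (use A in \<open>auto simp: qpoch_nonzero\<close>)
  hence f_cont: "continuous_on (sphere 0 1) f"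
    using sphA by (intro continuous_on_subset[OF holomorphic_on_imp_continuous_on]) auto
  have "circle_int f = circle_int (\<lambda>z. f (inverse z))"
    by (rule circle_int_inverse[OF f_cont, symmetric])
  also have "\<dots> = circle_int (\<lambda>z. (-1) * f z)"
  proof (rule circle_int_cong)
    fix z :: complex
    define E where "E = (\<lambda>z. Q q (q * z\<^sup>2) * Q q (q * inverse (z\<^sup>2)) /
        (Q q (a * s * z) * Q q (a * s * inverse z)))"
    have "E (inverse z) = E z" by (simp add: E_def power_inverse mult_ac)
    moreover have "f z = (inverse z - z) * E z" for z by (simp add: f_def E_def)
    ultimately show "f (inverse z) = (-1) * f z" by simp (simp add: algebra_simps)
  qed
  also have "\<dots> = - circle_int f" by (subst circle_int_cmult) simp
  finally have "circle_int f = 0" by (simp add: eq_neg_iff_add_eq_0)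
  moreover have "circle_int (\<lambda>z. f (s * z)) = circle_int f"
    by (rule circle_int_scale[OF f_holo A_def sA oneA]) simp
  moreover have "circle_int ?g = circle_int (\<lambda>z. s * f (s * z))"
  proof (rule circle_int_cong)
    fix z :: complex assume z: "norm z = 1"
    hence z0: "z \<noteq> 0" by auto
    have "a * z \<noteq> 1"
    proof
      assume "a * z = 1"
      hence "norm (a * z) = 1" by simp
      thus False using z a by (simp add: norm_mult)
    qed
    define X Y U V where "X = Q q (q * z\<^sup>2)" and "Y = Q q (q * inverse (z\<^sup>2))"
      and "U = Q q (q * (a * z))" and "V = Q q (a * inverse z)"
    have UV: "U \<noteq> 0" "V \<noteq> 0" unfolding U_def V_def
      using norm_mult_less_1[OF q a] a z by (simp_all add: qpoch_nonzero norm_mult norm_divide norm_inverse)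
    have 1: "(s * z)\<^sup>2 = q * z\<^sup>2" "q * inverse (q * z\<^sup>2) = inverse (z\<^sup>2)"
      "a * s * (s * z) = q * (a * z)" "a * s * inverse (s * z) = a * inverse z"
      using s z0 False by (auto simp: power_mult_distrib field_simps power2_eq_square)
    have 2: "X = (1 - q * z\<^sup>2) * Q q (q * (q * z\<^sup>2))"
      unfolding X_def by (rule qpoch_step)
    have 3: "Q q (inverse (z\<^sup>2)) = (1 - inverse (z\<^sup>2)) * Y"
      unfolding Y_def by (rule qpoch_step)
    have 4: "aw_factor q a z = (1 - a * z) * U * V"
      unfolding aw_factor_def U_def V_def qpoch_step[of "a * z"] ..
    have 5: "s * (inverse (s * z) - s * z) = inverse z * (1 - q * z\<^sup>2)"
      using s z0 by (auto simp: field_simps power2_eq_square)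
    have 6: "inverse z - a = inverse z * (1 - a * z)" using z0 by (simp add: field_simps)
    have "s * f (s * z) = (s * (inverse (s * z) - s * z)) *
            (Q q (q * (q * z\<^sup>2)) * ((1 - inverse (z\<^sup>2)) * Y)) / (U * V)"
      unfolding f_def 1 3 U_def[symmetric] V_def[symmetric] by (simp add: mult_ac)
    also have "\<dots> = inverse z * X * (1 - inverse (z\<^sup>2)) * Y / (U * V)"
      unfolding 5 2 by (simp add: mult_ac)
    also have "\<dots> = ?g z"
      unfolding X_def[symmetric] Y_def[symmetric] 4 6 using UV \<open>a * z \<noteq> 1\<close> by (simp add: mult_ac)
    finally show "?g z = s * f (s * z)" ..
  qed
  ultimately show ?thesis by (simp add: circle_int_cmult)
qed

text \<open>Passing from $a$ to $qa$ multiplies the integrand by $(1 - az)(1 - a/z) = 1 - a(z + 1/z - a)$. The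
  difference of the two integrands is therefore $a(z + 1/z - a)$ times the first one. This is $a$ times
  the symmetrisation of the integrand $g$ of the previous lemma, because
  \[ (z + 1/z - a)(1 - z^2)(1 - z^{-2}) = (1/z - a)(1 - z^{-2}) + (z - a)(1 - z^2). \]\<close>
lemma aw_integral_one_parameter_scale:
  assumes a: "norm a < 1"
  shows "aw_integral q (q * a) 0 0 0 = aw_integral q a 0 0 0"
proof -
  define g where "g = (\<lambda>z. (inverse z - a) * (1 - inverse (z\<^sup>2)) *
           (Q q (q * z\<^sup>2) * Q q (q * inverse (z\<^sup>2))) / aw_factor q a z)"
  have g: "continuous_on (sphere 0 1) g" unfolding g_def
    by (intro continuous_intros qpoch_continuous_on)
       (use a in \<open>auto simp: aw_factor_def qpoch_nonzero norm_mult norm_inverse intro!: continuous_intros qpoch_continuous_on\<close>)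
  have g': "continuous_on (sphere 0 1) (\<lambda>z. g (inverse z))"
    by (intro continuous_on_compose2[OF g] continuous_intros) (auto simp: norm_inverse)
  have g0: "circle_int g = 0" unfolding g_def by (rule aw_shift_integral[OF a])
  have "aw_integral q a 0 0 0 - aw_integral q (q * a) 0 0 0 =
          circle_int (\<lambda>z. aw_integrand q a 0 0 0 z - aw_integrand q (q * a) 0 0 0 z)"
    unfolding aw_integral_def using a q
    by (intro circle_int_diff[symmetric] aw_integrand_continuous norm_mult_less_1) auto
  also have "\<dots> = circle_int (\<lambda>z. a * (g z + g (inverse z)))"
  proof (rule circle_int_cong)
    fix z :: complex assume z: "norm z = 1"
    hence z0: "z \<noteq> 0" by auto
    note nz = aw_factor_nonzero[OF a z]
    define X where "X = Q q (q * z\<^sup>2) * Q q (q * inverse (z\<^sup>2)) / aw_factor q a z"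
    have w: "aw_weight q z / aw_factor q a z = (1 - z\<^sup>2) * (1 - inverse (z\<^sup>2)) * X"
      unfolding aw_weight_def X_def qpoch_step[of "z\<^sup>2"] qpoch_step[of "inverse (z\<^sup>2)"] by simp
    have i1: "aw_integrand q a 0 0 0 z = (1 - z\<^sup>2) * (1 - inverse (z\<^sup>2)) * X"
      by (simp add: aw_integrand_def w)
    have "aw_integrand q (q * a) 0 0 0 z = (1 - a * z) * (1 - a * inverse z) * (aw_weight q z / aw_factor q a z)"
      using nz unfolding aw_factor_step[OF z0, of a] by (simp add: aw_integrand_def)
    hence i2: "aw_integrand q (q * a) 0 0 0 z = (1 - a * z) * (1 - a * inverse z) * ((1 - z\<^sup>2) * (1 - inverse (z\<^sup>2)) * X)"
      unfolding w .
    have "aw_factor q a (inverse z) = aw_factor q a z" by (simp add: aw_factor_def)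
    hence i3: "g (inverse z) = (z - a) * (1 - z\<^sup>2) * X"
      by (simp add: g_def X_def power_inverse mult_ac)
    have i4: "g z = (inverse z - a) * (1 - inverse (z\<^sup>2)) * X" by (simp add: g_def X_def)
    have "(1 - z\<^sup>2) * (1 - inverse (z\<^sup>2)) - (1 - a * z) * (1 - a * inverse z) * ((1 - z\<^sup>2) * (1 - inverse (z\<^sup>2))) =
          a * ((inverse z - a) * (1 - inverse (z\<^sup>2)) + (z - a) * (1 - z\<^sup>2))"
      using z0 by (simp add: field_simps power2_eq_square)
    from arg_cong[OF this, of "\<lambda>y. y * X"]
    show "aw_integrand q a 0 0 0 z - aw_integrand q (q * a) 0 0 0 z = a * (g z + g (inverse z))"
      unfolding i1 i2 i3 i4 by (simp add: algebra_simps)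
  qed
  also have "\<dots> = a * (circle_int g + circle_int (\<lambda>z. g (inverse z)))"
    by (simp add: circle_int_cmult circle_int_add[OF g g'])
  also have "\<dots> = 0" by (simp add: circle_int_inverse[OF g] g0)
  finally show ?thesis by simp
qed

lemma aw_integral_one_parameter:
  assumes a: "norm a < 1"
  shows "aw_integral q a 0 0 0 = aw_integral q 0 0 0 0"
proof -
  have iter: "aw_integral q (q ^ n * a) 0 0 0 = aw_integral q a 0 0 0 \<and> norm (q ^ n * a) < 1" for n
  proof (induction n)
    case (Suc n)
    thus ?case using aw_integral_one_parameter_scale[of "q ^ n * a"] norm_mult_less_1[OF q, of "q ^ n * a"]
      by (simp add: mult.assoc)
  qed (use a in auto)
  have "(\<lambda>n. q ^ n * a) \<longlonglongrightarrow> 0"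
    using tendsto_mult_left_zero[OF LIMSEQ_power_zero[OF q]] by simp
  moreover have "continuous_on (ball 0 1) (\<lambda>b. aw_integral q 0 b 0 0)"
    by (intro holomorphic_on_imp_continuous_on aw_integral_holomorphic) auto
  hence "isCont (\<lambda>b. aw_integral q 0 b 0 0) 0"
    by (simp add: continuous_on_eq_continuous_at)
  ultimately have "(\<lambda>n. aw_integral q 0 (q ^ n * a) 0 0) \<longlonglongrightarrow> aw_integral q 0 0 0 0"
    by (rule isCont_tendsto_compose[rotated])
  moreover have "aw_integral q 0 (q ^ n * a) 0 0 = aw_integral q a 0 0 0" for n
    using iter[of n] aw_integral_commute(1)[of q 0 "q ^ n * a" 0 0] by simp
  ultimately show ?thesis by (simp add: LIMSEQ_const_iff)
qed

section \<open>All parameters\<close>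

text \<open>One more parameter: the difference of the two sides satisfies the hypotheses of the uniqueness
  lemma, as both sides are symmetric in $a$ and $b$.\<close>
lemma aw_integral_product_extend:
  assumes base: "\<And>a. norm a < 1 \<Longrightarrow> aw_integral q a 0 c d = C * aw_product q a 0 c d"
    and ab: "norm a < 1" "norm b < 1" and cd: "norm c < 1" "norm d < 1"
  shows "aw_integral q a b c d = C * aw_product q a b c d"
proof -
  have "aw_integral q a b c d - C * aw_product q a b c d = 0"
  proof (rule functional_equation_unique[OF q _ _ _ _ ab])
    fix a :: complex assume a: "norm a < 1"
    show "(\<lambda>b. aw_integral q a b c d - C * aw_product q a b c d) holomorphic_on ball 0 1"
      using a cd by (intro holomorphic_intros aw_integral_holomorphic aw_product_holomorphic)
    show "aw_integral q a 0 c d - C * aw_product q a 0 c d = 0" using base[OF a] by simp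
    show "aw_integral q 0 a c d - C * aw_product q 0 a c d = 0"
      using base[OF a] by (simp add: aw_integral_commute(1)[of q 0] aw_product_commute(1)[of q 0])
    fix b :: complex assume b: "norm b < 1"
    show "(b - a) * (1 - a * b) * (aw_integral q a b c d - C * aw_product q a b c d) =
        b * (aw_integral q (q * a) b c d - C * aw_product q (q * a) b c d) -
        a * (aw_integral q a (q * b) c d - C * aw_product q a (q * b) c d)"
    proof -
      have "(b - a) * (1 - a * b) * (aw_integral q a b c d - C * aw_product q a b c d) =
          (b - a) * (1 - a * b) * aw_integral q a b c d - C * ((b - a) * (1 - a * b) * aw_product q a b c d)"
        by (simp add: algebra_simps)
      thus ?thesis unfolding aw_integral_equation[OF a b cd] aw_product_equation[OF a b cd]
        by (simp add: algebra_simps)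
    qed
  qed
  thus ?thesis by simp
qed

text \<open>The parameters are switched on one at a time. Each step varies two parameters, one of which
  was zero before, so the symmetry in the parameters is needed to bring the previous case into the form
  with the zero in second position.\<close>
lemma aw_integral_eq_const_mult:
  assumes "norm a < 1" "norm b < 1" "norm c < 1" "norm d < 1"
  shows "aw_integral q a b c d = aw_integral q 0 0 0 0 * aw_product q a b c d"
proof -
  define C where "C = aw_integral q 0 0 0 0"
  have 1: "aw_integral q a 0 0 0 = C * aw_product q a 0 0 0" if "norm a < 1" for a
    using aw_integral_one_parameter[OF that] by (simp add: C_def aw_product_def qpoch_0)
  have 2: "aw_integral q a b 0 0 = C * aw_product q a b 0 0" if "norm a < 1" "norm b < 1" for a b
    by (rule aw_integral_product_extend) (use that 1 in auto)
  have 3: "aw_integral q a b c 0 = C * aw_product q a b c 0" if "norm a < 1" "norm b < 1" "norm c < 1" for a b c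
    by (rule aw_integral_product_extend)
       (use that 2 in \<open>auto simp: aw_integral_commute(2)[of q _ 0] aw_product_commute(2)[of q _ 0]\<close>)
  have 4: "aw_integral q a 0 c d = C * aw_product q a 0 c d" if "norm a < 1" "norm c < 1" "norm d < 1" for a c d
    using 3[of a c d] that
    by (simp add: aw_integral_commute(2)[of q _ 0 c] aw_product_commute(2)[of q _ 0 c]
        aw_integral_commute(3)[of q _ c 0 d] aw_product_commute(3)[of q _ c 0 d])
  show ?thesis unfolding C_def[symmetric]
    by (rule aw_integral_product_extend) (use assms 4 in auto)
qed

section \<open>The constant\<close>

text \<open>For these parameters the denominator cancels all of the weight except
  $(1 - z^2)(1 - z^{-2}) = 2 - z^2 - z^{-2}$, by the formula for $(z^2; q)_\infty$.\<close>
lemma aw_integral_special: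
  assumes s: "s\<^sup>2 = q"
  shows "aw_integral q s (- s) q (- q) = 4 * pi"
proof -
  have s1: "norm s < 1"
    using s by (intro norm_sqrt_less_1)
  have c1: "continuous_on (sphere 0 1) (\<lambda>z::complex. z\<^sup>2)" by (intro continuous_intros)
  have c2: "continuous_on (sphere 0 1) (\<lambda>z::complex. (inverse z)\<^sup>2)"
    by (intro continuous_intros) auto
  have z2: "circle_int (\<lambda>z. z\<^sup>2) = 0"
    using circle_int_mult_holomorphic[of "\<lambda>z. z" 2] by (simp add: power2_eq_square)
  have Qs: "Q q (z\<^sup>2) = (1 - z\<^sup>2) * (Q q (s * z) * Q q (- s * z) *
              Q q (q * z) * Q q (- q * z))" for z
    unfolding qpoch_square[OF s] qpoch_step[of z] qpoch_step[of "-z"]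
    by (simp add: algebra_simps power2_eq_square)
  have "aw_integral q s (- s) q (- q) = circle_int (\<lambda>z. 2 - (z\<^sup>2 + (inverse z)\<^sup>2))"
    unfolding aw_integral_def
  proof (rule circle_int_cong)
    fix z :: complex assume z: "norm z = 1"
    hence z0: "z \<noteq> 0" by auto
    have nz: "aw_factor q s z \<noteq> 0" "aw_factor q (- s) z \<noteq> 0" "aw_factor q q z \<noteq> 0" "aw_factor q (- q) z \<noteq> 0"
      by (rule aw_factor_nonzero; use s1 q z in simp)+
    have "aw_weight q z = (1 - z\<^sup>2) * (1 - (inverse z)\<^sup>2) *
            (aw_factor q s z * aw_factor q (- s) z * aw_factor q q z * aw_factor q (- q) z)"
      unfolding aw_weight_def power_inverse[symmetric] Qs aw_factor_def by (simp add: mult_ac)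
    hence "aw_integrand q s (- s) q (- q) z = (1 - z\<^sup>2) * (1 - (inverse z)\<^sup>2)"
      using nz by (simp add: aw_integrand_def)
    also have "\<dots> = 2 - (z\<^sup>2 + (inverse z)\<^sup>2)"
      using z0 by (simp add: field_simps power2_eq_square)
    finally show "aw_integrand q s (- s) q (- q) z = 2 - (z\<^sup>2 + (inverse z)\<^sup>2)" .
  qed
  also have "\<dots> = circle_int (\<lambda>z. 2) - (circle_int (\<lambda>z. z\<^sup>2) + circle_int (\<lambda>z. (inverse z)\<^sup>2))"
    by (simp add: circle_int_diff circle_int_add c1 c2 continuous_on_add)
  also have "\<dots> = 4 * pi"
    using z2 circle_int_inverse[OF c1] by (simp add: circle_int_const)
  finally show ?thesis .
qed

text \<open>The formula for $(z^2; q)_\infty$ at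
  $z = s$ gives $(s, -s, -q)_\infty = 1$ (which is Euler's identity between partitions into odd and into
  distinct parts), and splitting off the first factors of the products reduces the claim to this.\<close>
lemma aw_product_special:
  assumes s: "s\<^sup>2 = q"
  shows "aw_product q s (- s) q (- q) = Q q q"
proof -
  have s1: "norm s < 1"
    using s by (intro norm_sqrt_less_1)
  have nz: "Q q q \<noteq> 0" "Q q (- q) \<noteq> 0" "Q q (s * q) \<noteq> 0" "Q q (- (s * q)) \<noteq> 0" "Q q (- (q * q)) \<noteq> 0"
      "Q q (q * q) \<noteq> 0"
    using q s1 by (auto intro!: qpoch_nonzero norm_mult_less_1 simp del: norm_mult simp: norm_mult_less_1)
  have e1: "Q q s * Q q (- s) * Q q (- q) = 1"
    using qpoch_square[OF s, of s] s nz by (simp add: power2_eq_square mult.assoc)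
  have e2: "Q q s = (1 - s) * Q q (s * q)" "Q q (- s) = (1 + s) * Q q (- (s * q))"
    using qpoch_step[of s] qpoch_step[of "-s"] by (simp_all add: mult.commute)
  have e3: "(1 - q) * (Q q (s * q) * Q q (- (s * q))) * Q q (- q) = 1"
    using e1 unfolding e2 by (simp add: algebra_simps s[symmetric] power2_eq_square)
  have e4: "Q q (- q) = (1 + q) * Q q (- (q * q))"
    using qpoch_step[of "-q"] by simp
  have e5: "Q q q = (1 - q) * ((1 - q * q) * Q q (q * q * q))"
    using qpoch_step[of q] qpoch_step[of "q * q"] by (simp add: mult.assoc)
  have "aw_product q s (- s) q (- q) = Q q (q * q * q) /
          (Q q (- q) * (Q q (s * q) * Q q (- (s * q))) * (Q q (s * q) * Q q (- (s * q))) * Q q (- (q * q)))"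
    by (simp add: aw_product_def s[symmetric] power2_eq_square mult_ac)
  also have "\<dots> = Q q q"
  proof -
    define Y where "Y = Q q (s * q) * Q q (- (s * q))"
    have Y: "Y * ((1 - q) * Q q (- q)) = 1" using e3 by (simp add: Y_def mult_ac)
    hence "Q q (- q) * Y * Y * Q q (- (q * q)) * Q q q = Q q (q * q * q)"
    proof -
      have "Q q (- q) * Y * Y * Q q (- (q * q)) * Q q q =
             ((1 - q) * Q q (-q) * Y) * ((1 - q) * ((1 + q) * Q q (- (q * q))) * Y) * Q q (q * q * q)"
        unfolding e5 by (simp add: algebra_simps)
      also have "\<dots> = Q q (q * q * q)" unfolding e4[symmetric] using Y by (simp add: mult_ac)
      finally show ?thesis .
    qed
    thus ?thesis unfolding Y_def[symmetric] using nz Y_def by (simp add: field_simps)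
  qed
  finally show ?thesis .
qed

text \<open>The special parameters determine the remaining constant, the integral without parameters, as $4\pi/(q)_\infty$.\<close>
theorem aw_integral_eq:
  assumes "norm a < 1" "norm b < 1" "norm c < 1" "norm d < 1"
  shows "aw_integral q a b c d = 4 * pi / Q q q * aw_product q a b c d"
proof -
  define s where "s = csqrt q"
  have s: "s\<^sup>2 = q" by (simp add: s_def)
  have s1: "norm s < 1"
    using s by (intro norm_sqrt_less_1)
  have "4 * pi = aw_integral q 0 0 0 0 * Q q q"
    using aw_integral_eq_const_mult[of s "-s" q "-q"] s1 q
    by (simp add: aw_integral_special[OF s] aw_product_special[OF s])
  thus ?thesis using aw_integral_eq_const_mult[OF assms] qpoch_nonzero[OF q] by (simp add: field_simps)
qed

end

section \<open>From the interval to the circle\<close>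

lemma aw_infinite_product:
  assumes q: "norm q < 1" and z: "z \<noteq> 0" and x: "2 * x = z + inverse z"
  shows "(\<lambda>n. l x (q ^ n) / (v x (a * q ^ n) * v x (b * q ^ n) * v x (c * q ^ n) * v x (d * q ^ n)))
           has_prod aw_integrand q a b c d z"
proof -
  have x': "x = (z + inverse z) / 2" using x by (simp add: field_simps)
  have v: "v x (a * q ^ n) = (1 - a * z * q ^ n) * (1 - a * inverse z * q ^ n)" for a n
    unfolding v_def x' using z by (simp add: field_simps power2_eq_square)
  have l: "l x (q ^ n) = (1 - z\<^sup>2 * q ^ n) * (1 - inverse (z\<^sup>2) * q ^ n)" for n
    unfolding l_def x' using z by (simp add: field_simps power2_eq_square)
  show ?thesis
    unfolding v l aw_integrand_def aw_weight_def aw_factor_def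
    by (intro has_prod_divide has_prod_mult qpoch_has_prod[OF q])
qed

text \<open>The left-hand side is an improper integral. The fundamental theorem applies on the open interval
  with the antiderivative $-H(\arccos x)$, $H(s) = \int_0^s h$, which extends continuously to the end
  points. Integrability follows by comparison with $1/\sqrt{1 - x^2}$, the derivative of the arcsine.\<close>
lemma arccos_substitution_integral:
  fixes h :: "real \<Rightarrow> complex"
  assumes h: "continuous_on {0..pi} h"
  shows "(LBINT x=-1..1. 1 / complex_of_real (sqrt (1 - x\<^sup>2)) * h (arccos x)) = integral {0..pi} h"
proof -
  have m1: "(-1 :: ereal) = ereal (-1)" and p1: "(1 :: ereal) = ereal 1"
    by (simp_all add: one_ereal_def)
  have lt: "(-1 :: ereal) < 1" by (simp add: one_ereal_def)
  have bnd: "x\<^sup>2 < 1" if "-1 < x" "x < 1" for x :: real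
    using that by (simp add: abs_square_less_1 abs_less_iff)
  have ac: "0 < arccos x" "arccos x < pi" if "-1 < x" "x < 1" for x
    using arccos_lt_bounded[OF that] by auto
  have int1: "set_integrable lborel (einterval (-1) 1) (\<lambda>x. inverse (sqrt (1 - x\<^sup>2)))"
  proof (rule interval_integral_FTC_nonneg(1))
    show "DERIV arcsin x :> inverse (sqrt (1 - x\<^sup>2))" if "-1 < ereal x" "ereal x < 1" for x
      using that unfolding m1 p1 by (intro DERIV_arcsin) auto
    show "isCont (\<lambda>x. inverse (sqrt (1 - x\<^sup>2))) x" if "-1 < ereal x" "ereal x < 1" for x
      using that bnd[of x] unfolding m1 p1 by (intro continuous_intros) auto
    show "AE x in lborel. -1 < ereal x \<longrightarrow> ereal x < 1 \<longrightarrow> 0 \<le> inverse (sqrt (1 - x\<^sup>2))"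
      using bnd unfolding m1 p1 by (intro AE_I2) (auto simp: less_imp_le)
    have "(arcsin \<longlongrightarrow> arcsin (-1)) (at (-1) within {-1..1})"
         "(arcsin \<longlongrightarrow> arcsin 1) (at 1 within {-1..1})"
      using continuous_on_arcsin'[unfolded continuous_on_def] by (force simp del: arcsin_minus_1 arcsin_1)+
    thus "((arcsin \<circ> real_of_ereal) \<longlongrightarrow> arcsin (-1)) (at_right (-1))"
         "((arcsin \<circ> real_of_ereal) \<longlongrightarrow> arcsin 1) (at_left 1)"
      unfolding p1 uminus_ereal.simps ereal_tendsto_simps
      by (simp_all add: at_within_Icc_at_right at_within_Icc_at_left)
  qed (rule lt)
  define H where "H = (\<lambda>s. integral {0..s} h)"
  have H: "(H has_vector_derivative h s) (at s)" if "0 < s" "s < pi" for s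
    using integral_has_vector_derivative[OF h, of s] that
    unfolding H_def by (simp add: at_within_Icc_at)
  have Hc: "continuous_on {0..pi} H"
    unfolding H_def by (intro indefinite_integral_continuous_1 integrable_continuous_real h)
  have hc: "continuous_on {-1<..<1} (\<lambda>x. h (arccos x))"
    by (intro continuous_on_compose2[OF h] continuous_intros) (auto simp: arccos_lbound arccos_ubound)
  have fc: "continuous_on {-1<..<1} (\<lambda>x. 1 / complex_of_real (sqrt (1 - x\<^sup>2)) * h (arccos x))"
    using bnd by (intro continuous_intros hc) (auto simp: less_le)
  obtain B where B: "\<And>s. s \<in> {0..pi} \<Longrightarrow> norm (h s) \<le> B"
    using compact_imp_bounded[OF compact_continuous_image[OF h compact_Icc]] unfolding bounded_iff by blast
  have "(LBINT x=-1..1. 1 / complex_of_real (sqrt (1 - x\<^sup>2)) * h (arccos x)) = - H 0 - (- H pi)"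
  proof (rule interval_integral_FTC_integrable[where F = "\<lambda>x. - H (arccos x)"])
    fix x assume "-1 < ereal x" "ereal x < 1"
    hence x: "-1 < x" "x < 1" unfolding m1 p1 by auto
    have "((H \<circ> arccos) has_vector_derivative inverse (- sqrt (1 - x\<^sup>2)) *\<^sub>R h (arccos x)) (at x)"
      using x by (intro vector_diff_chain_at H ac)
        (use DERIV_arccos[OF x] in \<open>simp add: has_real_derivative_iff_has_vector_derivative[symmetric]\<close>)
    from has_vector_derivative_minus[OF this]
    show "((\<lambda>x. - H (arccos x)) has_vector_derivative 1 / complex_of_real (sqrt (1 - x\<^sup>2)) * h (arccos x)) (at x)"
      by (simp add: o_def scaleR_conv_of_real divide_inverse)
    show "isCont (\<lambda>x. 1 / complex_of_real (sqrt (1 - x\<^sup>2)) * h (arccos x)) x"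
      using fc x by (simp add: continuous_on_eq_continuous_at)
  next
    show "set_integrable lborel (einterval (-1) 1) (\<lambda>x. 1 / complex_of_real (sqrt (1 - x\<^sup>2)) * h (arccos x))"
    proof (rule set_integrable_bound)
      show "set_integrable lborel (einterval (-1) 1) (\<lambda>x. B * inverse (sqrt (1 - x\<^sup>2)))"
        using int1 by simp
      show "set_borel_measurable lborel (einterval (-1) 1) (\<lambda>x. 1 / complex_of_real (sqrt (1 - x\<^sup>2)) * h (arccos x))"
        using borel_measurable_continuous_on_indicator[OF _ fc]
        unfolding set_borel_measurable_def m1 p1 einterval_eq by simp
      show "AE x in lborel. x \<in> einterval (-1) 1 \<longrightarrow>
          norm (1 / complex_of_real (sqrt (1 - x\<^sup>2)) * h (arccos x)) \<le> norm (B * inverse (sqrt (1 - x\<^sup>2)))"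
      proof (intro AE_I2 impI)
        fix x :: real assume "x \<in> einterval (-1) 1"
        hence x: "-1 < x" "x < 1" unfolding m1 p1 einterval_eq by auto
        have "norm (h (arccos x)) \<le> B" using ac[OF x] by (intro B) auto
        moreover have "0 < sqrt (1 - x\<^sup>2)" using bnd[OF x] by simp
        ultimately show "norm (1 / complex_of_real (sqrt (1 - x\<^sup>2)) * h (arccos x)) \<le> norm (B * inverse (sqrt (1 - x\<^sup>2)))"
          using order_trans[OF norm_ge_zero, of "h (arccos x)" B]
          by (simp add: norm_mult norm_divide norm_inverse divide_inverse mult_ac)
      qed
    qed
  next
    have c: "continuous_on {-1..1} (\<lambda>x. - H (arccos x))"
      by (intro continuous_intros continuous_on_compose2[OF Hc continuous_on_arccos'])
         (auto simp: arccos_lbound arccos_ubound)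
    have "((\<lambda>x. - H (arccos x)) \<longlongrightarrow> - H (arccos (-1))) (at (-1) within {-1..1})"
         "((\<lambda>x. - H (arccos x)) \<longlongrightarrow> - H (arccos 1)) (at 1 within {-1..1})"
      using c[unfolded continuous_on_def] by (force simp del: arccos_minus_1 arccos_1)+
    thus "(((\<lambda>x. - H (arccos x)) \<circ> real_of_ereal) \<longlongrightarrow> - H pi) (at_right (-1))"
         "(((\<lambda>x. - H (arccos x)) \<circ> real_of_ereal) \<longlongrightarrow> - H 0) (at_left 1)"
      unfolding p1 uminus_ereal.simps ereal_tendsto_simps
      by (simp_all add: at_within_Icc_at_right at_within_Icc_at_left)
  qed (rule lt)
  thus ?thesis by (simp add: H_def)
qed

theorem mainTheorem3:
  fixes q :: real and a b c d :: complex
  assumes "-1 < q" and "q < 1"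
    and "norm a < 1" and "norm b < 1" and "norm c < 1" and "norm d < 1"
  shows "1 / (2 * complex_of_real pi) *
      (LBINT x=-1..1. 1 / complex_of_real (sqrt (1 - x\<^sup>2)) *
        (\<Prod>n. l (complex_of_real x) (complex_of_real q ^ n) /
          (v (complex_of_real x) (a * complex_of_real q ^ n) *
           v (complex_of_real x) (b * complex_of_real q ^ n) *
           v (complex_of_real x) (c * complex_of_real q ^ n) *
           v (complex_of_real x) (d * complex_of_real q ^ n)))) =
    qpochhammer_inf (complex_of_real q) (a * b * c * d) /
    qpochhammer_inf_list (complex_of_real q)
      [complex_of_real q, a * b, a * c, a * d, b * c, b * d, c * d]"
proof -
  let ?q = "complex_of_real q"
  have q: "norm ?q < 1" using assms(1,2) by simp
  define h where "h = aw_integrand ?q a b c d"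
  have h: "continuous_on (sphere 0 1) h"
    unfolding h_def using assms(3-6) by (intro aw_integrand_continuous[OF q])
  have hc: "continuous_on {0..pi} (\<lambda>t. h (cis t))"
    by (rule continuous_on_compose2[OF h]) (auto intro!: continuous_intros)
  have prod_eq: "(\<Prod>n. l (complex_of_real x) (?q ^ n) /
          (v (complex_of_real x) (a * ?q ^ n) * v (complex_of_real x) (b * ?q ^ n) *
           v (complex_of_real x) (c * ?q ^ n) * v (complex_of_real x) (d * ?q ^ n))) = h (cis (arccos x))"
    if "-1 < x" "x < 1" for x
  proof -
    have "2 * complex_of_real x = cis (arccos x) + inverse (cis (arccos x))"
      using that by (simp add: complex_eq_iff)
    from aw_infinite_product[OF q cis_neq_zero this] show ?thesis
      unfolding h_def by (rule has_prod_unique[symmetric])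
  qed
  have "(LBINT x=-1..1. 1 / complex_of_real (sqrt (1 - x\<^sup>2)) *
        (\<Prod>n. l (complex_of_real x) (?q ^ n) /
          (v (complex_of_real x) (a * ?q ^ n) * v (complex_of_real x) (b * ?q ^ n) *
           v (complex_of_real x) (c * ?q ^ n) * v (complex_of_real x) (d * ?q ^ n)))) =
        (LBINT x=-1..1. 1 / complex_of_real (sqrt (1 - x\<^sup>2)) * h (cis (arccos x)))"
    by (rule interval_integral_cong) (simp add: prod_eq einterval_iff one_ereal_def)
  also have "\<dots> = integral {0..pi} (\<lambda>t. h (cis t))"
    by (rule arccos_substitution_integral[OF hc])
  also have "\<dots> = aw_integral ?q a b c d / 2"
  proof -
    have "h (inverse z) = h z" for z
      by (simp add: h_def aw_integrand_def aw_weight_def aw_factor_def mult.commute power_inverse)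
    thus ?thesis using circle_int_symmetric[OF h] by (simp add: aw_integral_def h_def)
  qed
  also have "\<dots> = 2 * pi / qpochhammer_inf ?q ?q * aw_product ?q a b c d"
    using aw_integral_eq[OF q assms(3-6)] by simp
  finally show ?thesis
    by (simp add: aw_product_def qpochhammer_inf_list_def mult.assoc)
qed

end
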